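(* Let $k$ be a field of characteristic zero and let $B$ be a subalgebra of the $k$-algebra $W_2$ of codimension $1$. Then $B$ is the linear span of $\xi_1,\xi_2,\xi_3,\xi_5,\xi_6$.
   Context: Let $E_2$ be a $2$-dimensional $k$-vector space with basis $v_1,v_2$. The algebra $W_2$ is the $6$-dimensional vector space of all commutative (symmetric) bilinear maps $E_2\times E_2\to E_2$, with the (nonassociative) multiplication $$(A\cdot B)(x,y)=A(v_1,B(x,y))-B(A(v_1,x),y)-B(x,A(v_1,y)),\qquad x,y\in E_2.$$ For $i,j,m\in\{1,2\}$ let $\alpha_{ij}^m$ be the bilinear map with $\alpha_{ij}^m(v_t,v_l)=\delta_{it}\delta_{jl}v_m$. Put $\xi_1=\alpha_{11}^1$, $\xi_2=\alpha_{12}^1+\alpha_{21}^1$, $\xi_3=\alpha_{22}^1$, $\xi_4=\alpha_{11}^2$, $\xi_5=\alpha_{12}^2+\alpha_{21}^2$, $\xi_6=\alpha_{22}^2$; these form a basis of $W_2$. A subalgebra is a linear subspace closed under the multiplication. *)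

theory Defs
  imports Complex_Main "HOL-Library.Function_Algebras"
begin

text \<open>
  A bilinear map on a vector space is a function \<open>'v \<Rightarrow> 'v \<Rightarrow> 'v\<close>. Zero and addition
  of such maps are the pointwise ones provided by \<^theory>\<open>HOL-Library.Function_Algebras\<close>;
  \<open>map_scale s\<close> is the corresponding pointwise scalar multiplication, where \<open>s\<close> is the
  scalar multiplication of the underlying vector space.
\<close>

definition map_scale :: "('k \<Rightarrow> 'v \<Rightarrow> 'v) \<Rightarrow> 'k \<Rightarrow> ('v \<Rightarrow> 'v \<Rightarrow> 'v) \<Rightarrow> ('v \<Rightarrow> 'v \<Rightarrow> 'v)"
  where "map_scale s c A = (\<lambda>x y. s c (A x y))"

definition bilinear_map ::
    "('k::field \<Rightarrow> 'v::ab_group_add \<Rightarrow> 'v) \<Rightarrow> ('v \<Rightarrow> 'v \<Rightarrow> 'v) \<Rightarrow> bool"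
  where "bilinear_map s A \<longleftrightarrow>
    (\<forall>x. Vector_Spaces.linear s s (\<lambda>y. A x y)) \<and> (\<forall>y. Vector_Spaces.linear s s (\<lambda>x. A x y))"

definition W2 :: "('k::field \<Rightarrow> 'v::ab_group_add \<Rightarrow> 'v) \<Rightarrow> ('v \<Rightarrow> 'v \<Rightarrow> 'v) set"
  where "W2 s = {A. bilinear_map s A \<and> (\<forall>x y. A x y = A y x)}"

text \<open>The multiplication of \<open>W2 s\<close>; it depends on the first basis vector \<open>v1\<close>.\<close>

definition W2_mult ::
    "'v::ab_group_add \<Rightarrow> ('v \<Rightarrow> 'v \<Rightarrow> 'v) \<Rightarrow> ('v \<Rightarrow> 'v \<Rightarrow> 'v) \<Rightarrow> ('v \<Rightarrow> 'v \<Rightarrow> 'v)"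
  where "W2_mult v1 A B = (\<lambda>x y. A v1 (B x y) - B (A v1 x) y - B x (A v1 y))"

definition W2_subalgebra ::
    "('k::field \<Rightarrow> 'v::ab_group_add \<Rightarrow> 'v) \<Rightarrow> 'v \<Rightarrow> ('v \<Rightarrow> 'v \<Rightarrow> 'v) set \<Rightarrow> bool"
  where "W2_subalgebra s v1 B \<longleftrightarrow>
    B \<subseteq> W2 s \<and> module.subspace (map_scale s) B \<and> (\<forall>A\<in>B. \<forall>C\<in>B. W2_mult v1 A C \<in> B)"

definition basis2 :: "('k::field \<Rightarrow> 'v::ab_group_add \<Rightarrow> 'v) \<Rightarrow> 'v \<Rightarrow> 'v \<Rightarrow> bool"
  where "basis2 s v1 v2 \<longleftrightarrow>
    v1 \<noteq> v2 \<and> \<not> module.dependent s {v1, v2} \<and> module.span s {v1, v2} = UNIV"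

text \<open>
  For \<open>u, w, z \<in> {v1, v2}\<close>, \<open>alpha s v1 v2 u w z\<close> is the bilinear map that sends the pair of
  basis vectors \<open>(u, w)\<close> to \<open>z\<close> and every other pair of basis vectors to \<open>0\<close>: the map
  \<open>\<alpha>\<^sub>i\<^sub>j\<^sup>m\<close> is \<open>alpha s v1 v2 v\<^sub>i v\<^sub>j v\<^sub>m\<close>. It is written with coordinates; the lemma
  \<open>alpha_characterization\<close> below shows that it is the unique bilinear map with these values.
\<close>

definition alpha ::
    "('k::field \<Rightarrow> 'v::ab_group_add \<Rightarrow> 'v) \<Rightarrow> 'v \<Rightarrow> 'v \<Rightarrow> 'v \<Rightarrow> 'v \<Rightarrow> 'v \<Rightarrow> ('v \<Rightarrow> 'v \<Rightarrow> 'v)"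
  where "alpha s v1 v2 u w z = (\<lambda>x y.
    s (module.representation s {v1, v2} x u * module.representation s {v1, v2} y w) z)"

definition "xi1 s v1 v2 = alpha s v1 v2 v1 v1 v1"
definition "xi2 s v1 v2 = alpha s v1 v2 v1 v2 v1 + alpha s v1 v2 v2 v1 v1"
definition "xi3 s v1 v2 = alpha s v1 v2 v2 v2 v1"
definition "xi4 s v1 v2 = alpha s v1 v2 v1 v1 v2"
definition "xi5 s v1 v2 = alpha s v1 v2 v1 v2 v2 + alpha s v1 v2 v2 v1 v2"
definition "xi6 s v1 v2 = alpha s v1 v2 v2 v2 v2"

lemma vector_space_map_scale:
  assumes "vector_space s"
  shows "vector_space (map_scale s)"
proof -
  interpret vector_space s by fact
  show ?thesis
    by unfold_locales
      (auto simp: map_scale_def fun_eq_iff scale_right_distrib scale_left_distrib)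
qed

lemma bilinear_map_iff:
  assumes "vector_space s"
  shows "bilinear_map s A \<longleftrightarrow>
    (\<forall>x y z. A x (y + z) = A x y + A x z) \<and> (\<forall>x c y. A x (s c y) = s c (A x y)) \<and>
    (\<forall>x y z. A (y + z) x = A y x + A z x) \<and> (\<forall>x c y. A (s c y) x = s c (A y x))"
  unfolding bilinear_map_def Vector_Spaces.linear_iff using assms by auto

lemma basis2_expand:
  assumes "vector_space s" and "basis2 s v1 v2"
  shows "x = s (module.representation s {v1, v2} x v1) v1
           + s (module.representation s {v1, v2} x v2) v2"
proof -
  interpret vector_space s by fact
  have "(\<Sum>b\<in>{v1, v2}. s (representation {v1, v2} x b) b) = x"
    using assms(2) by (intro sum_representation_eq) (auto simp: basis2_def)
  then show ?thesis using assms(2) by (simp add: basis2_def)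
qed

lemma bilinear_map_eqI:
  assumes vs: "vector_space s" and b: "basis2 s v1 v2"
    and A: "bilinear_map s A" and C: "bilinear_map s C"
    and eq: "\<And>t l. t \<in> {v1, v2} \<Longrightarrow> l \<in> {v1, v2} \<Longrightarrow> A t l = C t l"
  shows "A = C"
proof (intro ext)
  fix x y
  obtain a a' where x: "x = s a v1 + s a' v2" using basis2_expand[OF vs b, of x] by blast
  obtain c c' where y: "y = s c v1 + s c' v2" using basis2_expand[OF vs b, of y] by blast
  show "A x y = C x y"
    using A C unfolding bilinear_map_iff[OF vs] x y by (simp add: eq)
qed

lemma representation_basis2:
  assumes vs: "vector_space s" and b: "basis2 s v1 v2" and "t \<in> {v1, v2}"
  shows "module.representation s {v1, v2} t u = (if u = t then 1 else 0)"
proof -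
  interpret vector_space s by fact
  show ?thesis using assms(2,3) by (subst representation_basis) (auto simp: basis2_def)
qed

lemma bilinear_map_alpha:
  assumes vs: "vector_space s" and b: "basis2 s v1 v2"
  shows "bilinear_map s (alpha s v1 v2 u w z)"
proof -
  interpret vector_space s by fact
  have b': "independent {v1, v2}" "\<And>x. x \<in> span {v1, v2}"
    using b by (auto simp: basis2_def)
  show ?thesis
    unfolding bilinear_map_iff[OF vs] alpha_def
    by (simp add: representation_add[OF b'(1) b'(2) b'(2)] representation_scale[OF b'(1) b'(2)]
        algebra_simps)
qed

lemma alpha_basis:
  assumes "vector_space s" "basis2 s v1 v2" "t \<in> {v1, v2}" "l \<in> {v1, v2}"
  shows "alpha s v1 v2 u w z t l = (if u = t \<and> w = l then z else 0)"
proof -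
  interpret vector_space s by fact
  show ?thesis
    using representation_basis2[OF assms(1,2,3)] representation_basis2[OF assms(1,2,4)]
    by (simp add: alpha_def)
qed

lemma alpha_characterization:
  assumes "vector_space s" "basis2 s v1 v2"
  shows "A = alpha s v1 v2 u w z \<longleftrightarrow> bilinear_map s A \<and>
    (\<forall>t\<in>{v1, v2}. \<forall>l\<in>{v1, v2}. A t l = (if u = t \<and> w = l then z else 0))"
proof
  assume "A = alpha s v1 v2 u w z"
  then show "bilinear_map s A \<and>
      (\<forall>t\<in>{v1, v2}. \<forall>l\<in>{v1, v2}. A t l = (if u = t \<and> w = l then z else 0))"
    using bilinear_map_alpha[OF assms] alpha_basis[OF assms] by blast
next
  assume A: "bilinear_map s A \<and>
      (\<forall>t\<in>{v1, v2}. \<forall>l\<in>{v1, v2}. A t l = (if u = t \<and> w = l then z else 0))"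
  show "A = alpha s v1 v2 u w z"
  proof (rule bilinear_map_eqI[OF assms])
    fix t l assume "t \<in> {v1, v2}" "l \<in> {v1, v2}"
    then show "A t l = alpha s v1 v2 u w z t l"
      using A alpha_basis[OF assms] by metis
  qed (use A bilinear_map_alpha[OF assms] in blast)+
qed

end

theory Submission
  imports Defs
begin

text \<open>
  A subspace \<open>B\<close> of codimension one is the kernel of a nonzero linear functional \<open>f\<close>
  (\<open>codim_1_kernel\<close>). For fixed \<open>A\<close> the map \<open>C \<mapsto> A \<cdot> C\<close> is the natural action on symmetric
  bilinear maps of the endomorphism \<open>L\<^sub>A = A(v\<^sub>1, _)\<close> of \<open>E\<^sub>2\<close>. That \<open>B\<close> is closed under the
  multiplication says that for every \<open>A \<in> B\<close> this action preserves the kernel of \<open>f\<close>, hence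
  that \<open>f\<close> is an eigenvector of the dual action of \<open>L\<^sub>A\<close> (\<open>eigenfunctional\<close>).

  If \<open>f\<close> did not vanish on the kernel \<open>\<langle>\<xi>\<^sub>3, \<xi>\<^sub>6\<rangle>\<close> of \<open>A \<mapsto> L\<^sub>A\<close>, then \<open>L\<^sub>A\<close> would run through all of
  \<open>gl\<^sub>2\<close> as \<open>A\<close> runs through \<open>B\<close>, and \<open>f\<close> would span a one-dimensional \<open>gl\<^sub>2\<close>-submodule of the dual of
  \<open>W\<^sub>2\<close>. There is none, as that module is a sum of irreducible ones of dimensions two and four. So
  \<open>f\<close> vanishes at \<open>\<xi>\<^sub>3\<close> and \<open>\<xi>\<^sub>6\<close>, the endomorphisms \<open>L\<^sub>A\<close> with \<open>A \<in> B\<close> form a hyperplane in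
  \<open>gl\<^sub>2\<close>, and \<open>f\<close> is a weight vector for it. This forces the hyperplane to be
  the stabilizer of the line of \<open>v\<^sub>1\<close> and \<open>f\<close> to be a multiple of the \<open>\<xi>\<^sub>4\<close>-coordinate. In
  the basis \<open>\<xi>\<^sub>1, \<dots>, \<xi>\<^sub>6\<close> both steps are a short calculation with a few well-chosen \<open>A\<close>
  (\<open>common_eigenvector_coords\<close>).
\<close>

section \<open>Subspaces of codimension one and functionals\<close>

text \<open>
  The functional is the coordinate of a vector of \<open>V\<close> outside \<open>U\<close>, in a basis that consists of
  a basis of \<open>U\<close>, this vector, and further vectors. The dimension equation makes \<open>dim V\<close> positive,
  and this is where finiteness comes from: the dimension of a space without a finite basis is zero.
\<close>

lemma codim_1_kernel:
  fixes s :: "'k::field \<Rightarrow> 'a::ab_group_add \<Rightarrow> 'a"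
  assumes vs: "vector_space s"
    and U: "module.subspace s U" "U \<subseteq> V"
    and dim: "vector_space.dim s V = vector_space.dim s U + 1"
  obtains f where "Vector_Spaces.linear s (*) f"
    and "\<exists>x\<in>V. f x \<noteq> 0"
    and "U = {x\<in>V. f x = 0}"
proof -
  interpret vector_space s by fact
  obtain D where D: "D \<subseteq> V" "independent D" "V \<subseteq> span D" "card D = dim V"
    using basis_exists by blast
  then have finD: "finite D"
    using dim by (metis Suc_eq_plus1 card.infinite nat.distinct(1))
  obtain C where C: "C \<subseteq> U" "independent C" "U \<subseteq> span C" "card C = dim U"
    using basis_exists by blast
  have finC: "finite C"
    using independent_span_bound[OF finD C(2)] C(1) U(2) D(3) by blast
  have spanC: "span C = U"
    using C U by (metis span_minimal subset_antisym)
  obtain e where e: "e \<in> V" "e \<notin> U"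
    using dim U(2) by (metis add.right_neutral add_left_cancel subsetI subset_antisym zero_neq_one)
  have ind: "independent (insert e C)"
    using C(2) e(2) spanC by (simp add: independent_insertI)
  have V_le: "V \<subseteq> span (insert e C)"
  proof
    fix x assume x: "x \<in> V"
    show "x \<in> span (insert e C)"
    proof (rule ccontr)
      assume n: "x \<notin> span (insert e C)"
      then have "independent (insert x (insert e C))"
        using ind by (simp add: independent_insertI)
      moreover have "insert x (insert e C) \<subseteq> span D"
        using x e(1) C(1) U(2) D(3) by blast
      ultimately have "card (insert x (insert e C)) \<le> card D"
        using independent_span_bound[OF finD] by blast
      moreover have "x \<notin> insert e C" using n span_base by blast
      moreover have "e \<notin> C" using e(2) C(1) by blast
      ultimately show False
        using finC C(4) D(4) dim by simp
    qed
  qed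
  define E where "E = extend_basis (insert e C)"
  have E: "independent E" "span E = UNIV" "insert e C \<subseteq> E"
    unfolding E_def
    using independent_extend_basis[OF ind] span_extend_basis[OF ind]
      extend_basis_superset[OF ind] by auto
  define f where "f x = representation E x e" for x
  have add: "f (x + y) = f x + f y" for x y
    unfolding f_def using representation_add[OF E(1)] E(2) by simp
  have scale: "f (s c x) = c * f x" for c x
    unfolding f_def using representation_scale[OF E(1)] E(2) by simp
  have vk: "vector_space ((*) :: 'k \<Rightarrow> 'k \<Rightarrow> 'k)"
    by unfold_locales (auto simp: algebra_simps)
  have lin: "Vector_Spaces.linear s (*) f"
    using add scale vk vs by (simp add: Vector_Spaces.linear_iff)
  have fe: "f e = 1"
    unfolding f_def using representation_basis[OF E(1)] E(3) by simp
  have fC: "f c = 0" if "c \<in> C" for c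
  proof -
    have "c \<noteq> e" "c \<in> E" using that C(1) e(2) E(3) by auto
    then show ?thesis unfolding f_def using representation_basis[OF E(1)] by simp
  qed
  have fU: "f x = 0" if "x \<in> U" for x
  proof -
    have "x \<in> span C" using that spanC by simp
    then show ?thesis
    proof (induction rule: span_induct_alt)
      case base
      show ?case using scale[of 0 0] by simp
    next
      case (step c x y)
      then show ?case by (simp add: add scale fC)
    qed
  qed
  have Uf: "x \<in> U" if x: "x \<in> V" "f x = 0" for x
  proof -
    obtain k where k: "x - s k e \<in> span C"
      using V_le x(1) span_breakdown_eq by blast
    have "f x = f (x - s k e) + k * f e"
      using add[of "x - s k e" "s k e"] scale[of k e] by simp
    then have "k = 0"
      using fU[of "x - s k e"] k spanC fe x(2) by simp
    then show ?thesis using k spanC by simp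
  qed
  show ?thesis
  proof (rule that[OF lin])
    show "\<exists>x\<in>V. f x \<noteq> 0" using e(1) fe by force
    show "U = {x\<in>V. f x = 0}" using U(2) fU Uf by blast
  qed
qed

text \<open>
  Evaluating at a fixed vector \<open>e\<close> with \<open>f e \<noteq> 0\<close> gives the eigenvalue, because every \<open>x\<close> in \<open>V\<close>
  differs from a multiple of \<open>e\<close> by an element of the kernel.
\<close>

lemma eigenfunctional:
  fixes s :: "'k::field \<Rightarrow> 'a::ab_group_add \<Rightarrow> 'a"
  assumes vs: "vector_space s"
    and V: "module.subspace s V"
    and f: "Vector_Spaces.linear s (*) f"
    and e: "e \<in> V" "f e \<noteq> 0"
    and T: "Vector_Spaces.linear s s T"
    and inv: "\<And>x. x \<in> V \<Longrightarrow> f x = 0 \<Longrightarrow> f (T x) = 0"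
  obtains l where "\<And>x. x \<in> V \<Longrightarrow> f (T x) = l * f x"
proof
  interpret vector_space s by fact
  interpret f: Vector_Spaces.linear s "(*)" f by fact
  interpret T: Vector_Spaces.linear s s T by fact
  fix x assume x: "x \<in> V"
  let ?y = "x - s (f x / f e) e"
  have "?y \<in> V" using x e(1) V by (simp add: subspace_diff subspace_scale)
  moreover have "f ?y = 0" using e(2) by (simp add: f.diff f.scale)
  ultimately have "f (T ?y) = 0" by (rule inv)
  then show "f (T x) = (f (T e) / f e) * f x"
    by (simp add: T.diff T.scale f.diff f.scale)
qed

section \<open>The algebra in coordinates\<close>

definition W2_of_coords ::
    "('k::field \<Rightarrow> 'v::ab_group_add \<Rightarrow> 'v) \<Rightarrow> 'v \<Rightarrow> 'v \<Rightarrow> 'k \<Rightarrow> 'k \<Rightarrow> 'k \<Rightarrow> 'k \<Rightarrow> 'k \<Rightarrow> 'k \<Rightarrow>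
      ('v \<Rightarrow> 'v \<Rightarrow> 'v)"
  where "W2_of_coords s v1 v2 a1 a2 a3 a4 a5 a6 =
    map_scale s a1 (xi1 s v1 v2) + map_scale s a2 (xi2 s v1 v2) + map_scale s a3 (xi3 s v1 v2) +
    map_scale s a4 (xi4 s v1 v2) + map_scale s a5 (xi5 s v1 v2) + map_scale s a6 (xi6 s v1 v2)"

lemma subspace_W2:
  assumes vs: "vector_space s"
  shows "module.subspace (map_scale s) (W2 s)"
proof -
  interpret vector_space s by fact
  interpret M: vector_space "map_scale s" by (rule vector_space_map_scale[OF vs])
  show ?thesis
    unfolding M.subspace_def W2_def bilinear_map_iff[OF vs]
    by (auto simp: map_scale_def algebra_simps)
qed

lemma W2_mult_in_W2:
  assumes vs: "vector_space s" and A: "A \<in> W2 s" and C: "C \<in> W2 s"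
  shows "W2_mult v1 A C \<in> W2 s"
proof -
  interpret vector_space s by fact
  show ?thesis
    using A C unfolding W2_def W2_mult_def bilinear_map_iff[OF vs]
    by (auto simp: algebra_simps)
qed

lemma linear_W2_mult:
  assumes vs: "vector_space s" and A: "A \<in> W2 s"
  shows "Vector_Spaces.linear (map_scale s) (map_scale s) (W2_mult v1 A)"
proof -
  interpret vector_space s by fact
  show ?thesis
    using A vector_space_map_scale[OF vs]
    unfolding W2_def bilinear_map_iff[OF vs] Vector_Spaces.linear_iff
    by (auto simp: W2_mult_def map_scale_def fun_eq_iff algebra_simps)
qed

lemma W2_eqI:
  assumes vs: "vector_space s" and b: "basis2 s v1 v2"
    and A: "A \<in> W2 s" and C: "C \<in> W2 s"
    and "A v1 v1 = C v1 v1" "A v1 v2 = C v1 v2" "A v2 v2 = C v2 v2"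
  shows "A = C"
proof -
  have sym: "A v2 v1 = A v1 v2" "C v2 v1 = C v1 v2"
    using A C by (auto simp: W2_def)
  show ?thesis
    by (rule bilinear_map_eqI[OF vs b]) (use assms sym in \<open>auto simp: W2_def\<close>)
qed

context
  fixes s :: "'k::field \<Rightarrow> 'v::ab_group_add \<Rightarrow> 'v" and v1 v2 :: 'v
  assumes vs: "vector_space s" and b: "basis2 s v1 v2"
begin

lemma xi_in_W2:
  "xi1 s v1 v2 \<in> W2 s" "xi2 s v1 v2 \<in> W2 s" "xi3 s v1 v2 \<in> W2 s"
  "xi4 s v1 v2 \<in> W2 s" "xi5 s v1 v2 \<in> W2 s" "xi6 s v1 v2 \<in> W2 s"
proof -
  interpret vector_space s by (rule vs)
  have *: "bilinear_map s (A + C)" if "bilinear_map s A" "bilinear_map s C" for A C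
    using that unfolding bilinear_map_iff[OF vs] by (auto simp: algebra_simps)
  show "xi1 s v1 v2 \<in> W2 s" "xi2 s v1 v2 \<in> W2 s" "xi3 s v1 v2 \<in> W2 s"
    "xi4 s v1 v2 \<in> W2 s" "xi5 s v1 v2 \<in> W2 s" "xi6 s v1 v2 \<in> W2 s"
    unfolding W2_def xi1_def xi2_def xi3_def xi4_def xi5_def xi6_def
    by (auto intro!: * bilinear_map_alpha[OF vs b])
      (auto simp: alpha_def algebra_simps)
qed

lemma W2_of_coords_in_W2: "W2_of_coords s v1 v2 a1 a2 a3 a4 a5 a6 \<in> W2 s"
proof -
  interpret M: vector_space "map_scale s" by (rule vector_space_map_scale[OF vs])
  show ?thesis
    unfolding W2_of_coords_def
    by (intro M.subspace_add[OF subspace_W2[OF vs]] M.subspace_scale[OF subspace_W2[OF vs]]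
        xi_in_W2)
qed

lemma W2_of_coords_basis:
  "W2_of_coords s v1 v2 a1 a2 a3 a4 a5 a6 v1 v1 = s a1 v1 + s a4 v2"
  "W2_of_coords s v1 v2 a1 a2 a3 a4 a5 a6 v1 v2 = s a2 v1 + s a5 v2"
  "W2_of_coords s v1 v2 a1 a2 a3 a4 a5 a6 v2 v1 = s a2 v1 + s a5 v2"
  "W2_of_coords s v1 v2 a1 a2 a3 a4 a5 a6 v2 v2 = s a3 v1 + s a6 v2"
proof -
  interpret vector_space s by (rule vs)
  have "v1 \<noteq> v2" using b by (simp add: basis2_def)
  then show
    "W2_of_coords s v1 v2 a1 a2 a3 a4 a5 a6 v1 v1 = s a1 v1 + s a4 v2"
    "W2_of_coords s v1 v2 a1 a2 a3 a4 a5 a6 v1 v2 = s a2 v1 + s a5 v2"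
    "W2_of_coords s v1 v2 a1 a2 a3 a4 a5 a6 v2 v1 = s a2 v1 + s a5 v2"
    "W2_of_coords s v1 v2 a1 a2 a3 a4 a5 a6 v2 v2 = s a3 v1 + s a6 v2"
    by (simp_all add: W2_of_coords_def map_scale_def xi1_def xi2_def xi3_def xi4_def xi5_def
        xi6_def alpha_basis[OF vs b])
qed

lemma W2_coords:
  assumes A: "A \<in> W2 s"
  obtains a1 a2 a3 a4 a5 a6 where "A = W2_of_coords s v1 v2 a1 a2 a3 a4 a5 a6"
proof -
  obtain a1 a4 where "A v1 v1 = s a1 v1 + s a4 v2" using basis2_expand[OF vs b] by blast
  moreover obtain a2 a5 where "A v1 v2 = s a2 v1 + s a5 v2" using basis2_expand[OF vs b] by blast
  moreover obtain a3 a6 where "A v2 v2 = s a3 v1 + s a6 v2" using basis2_expand[OF vs b] by blast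
  ultimately have "A = W2_of_coords s v1 v2 a1 a2 a3 a4 a5 a6"
    by (intro W2_eqI[OF vs b A W2_of_coords_in_W2]) (simp_all add: W2_of_coords_basis)
  then show ?thesis by (rule that)
qed

text \<open>
  The right-hand side is free of \<open>a3\<close> and \<open>a6\<close>, since only the endomorphism \<open>A(v\<^sub>1, _)\<close> enters
  the product from the left.
\<close>

lemma W2_mult_of_coords:
  "W2_mult v1 (W2_of_coords s v1 v2 a1 a2 a3 a4 a5 a6) (W2_of_coords s v1 v2 c1 c2 c3 c4 c5 c6) =
    W2_of_coords s v1 v2
      (- a1 * c1 + a2 * c4 - 2 * a4 * c2)
      (a2 * c5 - a4 * c3 - a2 * c1 - a5 * c2)
      ((a1 - 2 * a5) * c3 + a2 * c6 - 2 * a2 * c2)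
      (a4 * c1 + (a5 - 2 * a1) * c4 - 2 * a4 * c5)
      (a4 * c2 - a1 * c5 - a4 * c6 - a2 * c4)
      (a4 * c3 - a5 * c6 - 2 * a2 * c5)"
  (is "W2_mult v1 ?A ?C = ?D")
proof -
  interpret vector_space s by (rule vs)
  have A: "?A \<in> W2 s" and C: "?C \<in> W2 s" by (rule W2_of_coords_in_W2)+
  note expand = A[unfolded W2_def bilinear_map_iff[OF vs] mem_Collect_eq, THEN conjunct1]
    C[unfolded W2_def bilinear_map_iff[OF vs] mem_Collect_eq, THEN conjunct1]
  \<comment> \<open>Each value is brought to the form \<open>p v\<^sub>1 + q v\<^sub>2\<close>; what remains are identities in \<open>k\<close>.\<close>
  have collect:
    "(s p v1 + s q v2) + (s p' v1 + s q' v2) = s (p + p') v1 + s (q + q') v2"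
    "(s p v1 + s q v2) - (s p' v1 + s q' v2) = s (p - p') v1 + s (q - q') v2"
    "s r (s p v1 + s q v2) = s (r * p) v1 + s (r * q) v2" for p p' q q' r
    by (simp_all add: scale_left_distrib scale_left_diff_distrib scale_right_distrib)
  have eqI: "s p v1 + s q v2 = s p' v1 + s q' v2" if "p = p'" "q = q'" for p p' q q'
    using that by simp
  show ?thesis
    by (rule W2_eqI[OF vs b W2_mult_in_W2[OF vs A C] W2_of_coords_in_W2];
        simp only: W2_mult_def expand W2_of_coords_basis collect;
        rule eqI; simp add: algebra_simps)
qed

end

section \<open>Common eigenvectors\<close>

text \<open>
  Here \<open>f\<^sub>i\<close> is the value of a functional \<open>f\<close> at \<open>\<xi>\<^sub>i\<close>, the numbers \<open>a\<^sub>i\<close> are the coordinates of an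
  element \<open>A\<close> of its kernel, and the \<open>i\<close>-th of the six equations says
  \<open>f (A \<cdot> \<xi>\<^sub>i) = l * f \<xi>\<^sub>i\<close>. As these do not involve \<open>a\<^sub>3\<close> and \<open>a\<^sub>6\<close>, the four other
  coordinates are arbitrary as soon as \<open>f\<^sub>3\<close> or \<open>f\<^sub>6\<close> is not zero; unit vectors then
  lead to a contradiction. After that, \<open>A\<close> is taken of the form \<open>f\<^sub>i \<xi>\<^sub>4 - f\<^sub>4 \<xi>\<^sub>i\<close>, which
  lies in the kernel of \<open>f\<close>.
\<close>

lemma common_eigenvector_coords:
  fixes f1 f2 f3 f4 f5 f6 :: "'k::field_char_0"
  assumes ev: "\<And>a1 a2 a3 a4 a5 a6.
      a1 * f1 + a2 * f2 + a3 * f3 + a4 * f4 + a5 * f5 + a6 * f6 = 0 \<Longrightarrow>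
      \<exists>l. - a1 * f1 + a4 * f4 - a2 * f2 = l * f1 \<and>
          - 2 * a4 * f1 - a5 * f2 + a4 * f5 - 2 * a2 * f3 = l * f2 \<and>
          - a4 * f2 + (a1 - 2 * a5) * f3 + a4 * f6 = l * f3 \<and>
          a2 * f1 + (a5 - 2 * a1) * f4 - a2 * f5 = l * f4 \<and>
          - 2 * a4 * f4 + a2 * f2 - a1 * f5 - 2 * a2 * f6 = l * f5 \<and>
          - a4 * f5 + a2 * f3 - a5 * f6 = l * f6"
  shows "f1 = 0" "f2 = 0" "f3 = 0" "f5 = 0" "f6 = 0"
proof -
  show f3: "f3 = 0"
  proof (rule ccontr)
    assume n: "f3 \<noteq> 0"
    obtain l where l: "f3 = l * f3" "0 = l * f2"
      using ev[of 1 0 "- f1 / f3" 0 0 0] n by auto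
    then have f2: "f2 = 0" using n by simp
    show False
      using ev[of 0 1 "- f2 / f3" 0 0 0] n f2 by auto
  qed
  show f6: "f6 = 0"
  proof (rule ccontr)
    assume n: "f6 \<noteq> 0"
    obtain l where l: "0 = l * f6" "- f1 = l * f1" "- f5 = l * f5"
      using ev[of 1 0 0 0 0 "- f1 / f6"] n by auto
    then have f15: "f1 = 0" "f5 = 0" using n by auto
    obtain m where m: "f3 = m * f6" "- f2 = m * f1" "f2 - 2 * f6 = m * f5"
      using ev[of 0 1 0 0 0 "- f2 / f6"] n by auto
    show False using m f15 n by simp
  qed
  show f2: "f2 = 0"
    using ev[of 0 "- f4" 0 f2 0 0] f3 f6 by auto
  show f5: "f5 = 0"
    using ev[of 0 0 0 f5 "- f4" 0] f3 f6 by auto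
  \<comment> \<open>Now \<open>\<xi>\<^sub>2\<close> lies in the kernel; acting by it maps \<open>f\<close> to \<open>f\<^sub>1\<close> times the \<open>\<xi>\<^sub>4\<close>-coordinate.\<close>
  show "f1 = 0"
    using ev[of 0 1 0 0 0 0] f2 f3 f5 f6 by auto
qed

theorem theorem6:
  fixes s :: "'k::field_char_0 \<Rightarrow> 'v::ab_group_add \<Rightarrow> 'v"
    and v1 v2 :: 'v
    and B :: "('v \<Rightarrow> 'v \<Rightarrow> 'v) set"
  assumes "vector_space s"
    and "basis2 s v1 v2"
    and "W2_subalgebra s v1 B"
    and "vector_space.dim (map_scale s) (W2 s) = vector_space.dim (map_scale s) B + 1"
  shows "B = module.span (map_scale s)
    {xi1 s v1 v2, xi2 s v1 v2, xi3 s v1 v2, xi5 s v1 v2, xi6 s v1 v2}"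
proof -
  note vs = assms(1) and b = assms(2)
  have vsM: "vector_space (map_scale s)" by (rule vector_space_map_scale[OF vs])
  interpret M: vector_space "map_scale s" by (rule vsM)
  have B: "B \<subseteq> W2 s" "M.subspace B" "\<And>A C. A \<in> B \<Longrightarrow> C \<in> B \<Longrightarrow> W2_mult v1 A C \<in> B"
    using assms(3) by (auto simp: W2_subalgebra_def)
  obtain f where f: "Vector_Spaces.linear (map_scale s) (*) f"
    and f_nz: "\<exists>A\<in>W2 s. f A \<noteq> 0" and B_ker: "B = {A\<in>W2 s. f A = 0}"
    using codim_1_kernel[OF vsM B(2,1) assms(4)] by blast
  interpret f: Vector_Spaces.linear "map_scale s" "(*)" f by fact
  obtain e where e: "e \<in> W2 s" "f e \<noteq> 0" using f_nz by blast
  let ?W = "W2_of_coords s v1 v2"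
  let ?f1 = "f (xi1 s v1 v2)" and ?f2 = "f (xi2 s v1 v2)" and ?f3 = "f (xi3 s v1 v2)"
    and ?f4 = "f (xi4 s v1 v2)" and ?f5 = "f (xi5 s v1 v2)" and ?f6 = "f (xi6 s v1 v2)"
  have f_coords: "f (?W a1 a2 a3 a4 a5 a6) =
      a1 * ?f1 + a2 * ?f2 + a3 * ?f3 + a4 * ?f4 + a5 * ?f5 + a6 * ?f6" for a1 a2 a3 a4 a5 a6
    unfolding W2_of_coords_def by (simp only: f.add f.scale)
  note inW = W2_of_coords_in_W2[OF vs b]
  have ev: "\<exists>l. - a1 * ?f1 + a4 * ?f4 - a2 * ?f2 = l * ?f1 \<and>
          - 2 * a4 * ?f1 - a5 * ?f2 + a4 * ?f5 - 2 * a2 * ?f3 = l * ?f2 \<and>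
          - a4 * ?f2 + (a1 - 2 * a5) * ?f3 + a4 * ?f6 = l * ?f3 \<and>
          a2 * ?f1 + (a5 - 2 * a1) * ?f4 - a2 * ?f5 = l * ?f4 \<and>
          - 2 * a4 * ?f4 + a2 * ?f2 - a1 * ?f5 - 2 * a2 * ?f6 = l * ?f5 \<and>
          - a4 * ?f5 + a2 * ?f3 - a5 * ?f6 = l * ?f6"
    if ker: "a1 * ?f1 + a2 * ?f2 + a3 * ?f3 + a4 * ?f4 + a5 * ?f5 + a6 * ?f6 = 0"
    for a1 a2 a3 a4 a5 a6
  proof -
    let ?A = "?W a1 a2 a3 a4 a5 a6"
    have A: "?A \<in> B" using ker inW by (simp add: B_ker f_coords)
    have inv: "f (W2_mult v1 ?A C) = 0" if "C \<in> W2 s" "f C = 0" for C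
      using B(3)[OF A] that by (auto simp: B_ker)
    obtain l where l: "\<And>C. C \<in> W2 s \<Longrightarrow> f (W2_mult v1 ?A C) = l * f C"
      using eigenfunctional[where T = "W2_mult v1 ?A" and f = f and e = e,
          OF vsM subspace_W2[OF vs] f e linear_W2_mult[OF vs inW] inv] by metis
    have l': "f (W2_mult v1 ?A (?W c1 c2 c3 c4 c5 c6)) = l * f (?W c1 c2 c3 c4 c5 c6)"
      for c1 c2 c3 c4 c5 c6 by (rule l[OF inW])
    note coords = W2_mult_of_coords[OF vs b] f_coords
    show ?thesis
    proof (intro exI[of _ l] conjI)
      show "- a1 * ?f1 + a4 * ?f4 - a2 * ?f2 = l * ?f1"
        using l'[of 1 0 0 0 0 0, unfolded coords] by algebra
      show "- 2 * a4 * ?f1 - a5 * ?f2 + a4 * ?f5 - 2 * a2 * ?f3 = l * ?f2"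
        using l'[of 0 1 0 0 0 0, unfolded coords] by algebra
      show "- a4 * ?f2 + (a1 - 2 * a5) * ?f3 + a4 * ?f6 = l * ?f3"
        using l'[of 0 0 1 0 0 0, unfolded coords] by algebra
      show "a2 * ?f1 + (a5 - 2 * a1) * ?f4 - a2 * ?f5 = l * ?f4"
        using l'[of 0 0 0 1 0 0, unfolded coords] by algebra
      show "- 2 * a4 * ?f4 + a2 * ?f2 - a1 * ?f5 - 2 * a2 * ?f6 = l * ?f5"
        using l'[of 0 0 0 0 1 0, unfolded coords] by algebra
      show "- a4 * ?f5 + a2 * ?f3 - a5 * ?f6 = l * ?f6"
        using l'[of 0 0 0 0 0 1, unfolded coords] by algebra
    qed
  qed
  have f0: "?f1 = 0" "?f2 = 0" "?f3 = 0" "?f5 = 0" "?f6 = 0"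
    by (rule common_eigenvector_coords, rule ev, assumption)+
  have f4: "?f4 \<noteq> 0"
  proof
    assume "?f4 = 0"
    moreover obtain a1 a2 a3 a4 a5 a6 where "e = ?W a1 a2 a3 a4 a5 a6"
      using W2_coords[OF vs b e(1)] by blast
    ultimately show False using e(2) f0 by (simp add: f_coords)
  qed
  let ?X = "{xi1 s v1 v2, xi2 s v1 v2, xi3 s v1 v2, xi5 s v1 v2, xi6 s v1 v2}"
  show ?thesis
  proof
    show "B \<subseteq> M.span ?X"
    proof
      fix A assume A: "A \<in> B"
      then obtain a1 a2 a3 a4 a5 a6 where a: "A = ?W a1 a2 a3 a4 a5 a6"
        using W2_coords[OF vs b] B(1) by blast
      have "a4 = 0" using A f0 f4 by (simp add: a B_ker f_coords)
      then show "A \<in> M.span ?X"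
        unfolding a W2_of_coords_def
        by (simp only: M.scale_zero_left add_0_right)
          (intro M.span_add M.span_scale M.span_base; simp)
    qed
    have "?X \<subseteq> B" using f0 xi_in_W2[OF vs b] by (simp add: B_ker)
    then show "M.span ?X \<subseteq> B" using B(2) by (rule M.span_minimal)
  qed
qed

end
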